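(* Let $A$ be an algebra endowed with a right action $(a,\gamma)\mapsto a\cdot\gamma$ of a group $\Gamma$ by automorphisms, let $E$ be a vector space, and let $\pi:A\to\mathrm{End}(E)$ and $\rho:\Gamma\to\mathrm{GL}(E)$ be representations defining a covariant system, i.e. $\pi(a\cdot\gamma)=\rho(\gamma^{-1})\pi(a)\rho(\gamma)$ for all $a\in A$, $\gamma\in\Gamma$; regard $E$ as a left $A$-module via $\pi$ and as a left $A\rtimes\Gamma$-module via $\pi'(a\otimes\gamma)=\rho(\gamma)\pi(a)$. Let $j:\Gamma\to Z(A)\cap A^*$ be a $1$-cocycle, and let $\delta:A\to A$ be a derivation with $\delta(a\cdot\gamma)=(\delta(a)\cdot\gamma)\,j\gamma$ for all $a\in A$, $\gamma\in\Gamma$. Fix $s\in\mathbb{N}$, $s\geq 1$, and let $\sigma$ and $\delta'_s$ be the automorphism and the $\sigma$-derivation of $A\rtimes\Gamma$ given by $$\sigma(a\otimes\gamma)=\big((j\gamma^{-1})\cdot\gamma\big)a\otimes\gamma,\qquad \delta'_s(a\otimes\gamma)=\Big(\delta\big((a\cdot\gamma^{-1})(j\gamma^{-1})^s\big)(j\gamma^{-1})^{-s}\otimes1\Big)\Big(1\otimes\gamma\Big).$$ Then a connection $\nabla:E\to E$ for $A$ (with respect to $\delta$) is a twisted connection for $A\rtimes\Gamma$ (with respect to $\sigma$ and $\delta'_s$) if and only if $$\nabla\rho(\gamma)=\rho(\gamma)\Big((s-1)\,\pi\big(\delta(j\gamma^{-1}\cdot\gamma)\big)+\nabla\,\pi(j\gamma^{-1}\cdot\gamma)\Big)\qquad\text{for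 all }\gamma\in\Gamma.$$
   Context: Algebras are associative, unital, not necessarily commutative, over $\mathbb{C}$. $Z(A)$ is the center of $A$ and $A^*$ its group of invertible elements. The algebraic crossed product $A\rtimes\Gamma$ is $A\otimes\mathbb{C}\Gamma$ as a vector space, with multiplication $(a\otimes\gamma)(b\otimes\mu)=(a\cdot\mu)b\otimes\gamma\mu$. A map $j:\Gamma\to Z(A)\cap A^*$ is a $1$-cocycle if $j(\gamma\mu)=\big((j\gamma)\cdot\mu\big)\,j\mu$ for all $\gamma,\mu\in\Gamma$. Here $j\gamma^{-1}$ means $j(\gamma^{-1})$ and $j\gamma^{-1}\cdot\gamma$ means $(j(\gamma^{-1}))\cdot\gamma$. For an automorphism $\sigma$ of an algebra $B$, a $\sigma$-derivation on $B$ is a linear map $d:B\to B$ with $d(xy)=d(x)y+\sigma(x)d(y)$. If $\delta$ is a derivation of an algebra $B$ and $E$ is a left $B$-module, a connection is a linear map $\nabla:E\to E$ with $\nabla(b\,\xi)=\delta(b)\xi+b\nabla(\xi)$ for all $b\in B$, $\xi\in E$. If $\sigma$ is an automorphism of $B$ and $\delta$ a $\sigma$-derivation of $B$, a twisted connection is a linear map $\nabla:E\to E$ with $\nabla(b\,\xi)=\delta(b)\xi+\sigma(b)\nabla(\xi)$ for all $b\in B$, $\xi\in E$. *)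

theory Defs
  imports Complex_Main "HOL-Library.Poly_Mapping"
begin

text \<open>
  Conventions. Groups \<open>\<Gamma>\<close> are types of class \<^class>\<open>group_add\<close> (not assumed commutative), so
  \<open>\<gamma>\<mu>\<close>, \<open>1\<close> and \<open>\<gamma>\<inverse>\<close> are written \<open>\<gamma> + \<mu>\<close>, \<open>0\<close> and \<open>- \<gamma>\<close>. The algebra \<open>A\<close> is a type of sort
  \<open>{ring, monoid_mult}\<close> and not \<open>ring_1\<close>, because the latter would exclude the zero algebra.
  Linear maps are those of \<^theory>\<open>HOL.Vector_Spaces\<close>, over \<^typ>\<open>complex\<close>.
\<close>


section \<open>Algebras, representations, connections\<close>

locale complex_algebra = vector_space scale
  for scale :: "complex \<Rightarrow> 'b::ab_group_add \<Rightarrow> 'b" +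
  fixes mult :: "'b \<Rightarrow> 'b \<Rightarrow> 'b" and one :: 'b
  assumes mult_assoc: "mult (mult x y) z = mult x (mult y z)"
    and mult_one_left: "mult one x = x"
    and mult_one_right: "mult x one = x"
    and mult_add_left: "mult (x + y) z = mult x z + mult y z"
    and mult_add_right: "mult x (y + z) = mult x y + mult x z"
    and mult_scale_left: "mult (scale c x) y = scale c (mult x y)"
    and mult_scale_right: "mult x (scale c y) = scale c (mult x y)"

definition algebra_automorphism ::
  "(complex \<Rightarrow> 'b::ab_group_add \<Rightarrow> 'b) \<Rightarrow> ('b \<Rightarrow> 'b \<Rightarrow> 'b) \<Rightarrow> 'b \<Rightarrow> ('b \<Rightarrow> 'b) \<Rightarrow> bool" where
  "algebra_automorphism scale mult one f \<longleftrightarrow>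
     Vector_Spaces.linear scale scale f \<and> bij f \<and> f one = one \<and>
     (\<forall>x y. f (mult x y) = mult (f x) (f y))"

definition derivation ::
  "(complex \<Rightarrow> 'b::ab_group_add \<Rightarrow> 'b) \<Rightarrow> ('b \<Rightarrow> 'b \<Rightarrow> 'b) \<Rightarrow> ('b \<Rightarrow> 'b) \<Rightarrow> bool" where
  "derivation scale mult d \<longleftrightarrow>
     Vector_Spaces.linear scale scale d \<and> (\<forall>x y. d (mult x y) = mult (d x) y + mult x (d y))"

definition twisted_derivation ::
  "(complex \<Rightarrow> 'b::ab_group_add \<Rightarrow> 'b) \<Rightarrow> ('b \<Rightarrow> 'b \<Rightarrow> 'b) \<Rightarrow> ('b \<Rightarrow> 'b) \<Rightarrow> ('b \<Rightarrow> 'b) \<Rightarrow> bool" where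
  "twisted_derivation scale mult \<sigma> d \<longleftrightarrow>
     Vector_Spaces.linear scale scale d \<and>
     (\<forall>x y. d (mult x y) = mult (d x) y + mult (\<sigma> x) (d y))"

definition algebra_representation ::
  "(complex \<Rightarrow> 'b::ab_group_add \<Rightarrow> 'b) \<Rightarrow> ('b \<Rightarrow> 'b \<Rightarrow> 'b) \<Rightarrow> 'b \<Rightarrow>
   (complex \<Rightarrow> 'e::ab_group_add \<Rightarrow> 'e) \<Rightarrow> ('b \<Rightarrow> 'e \<Rightarrow> 'e) \<Rightarrow> bool" where
  "algebra_representation scale mult one scaleE \<pi> \<longleftrightarrow>
     (\<forall>b. Vector_Spaces.linear scaleE scaleE (\<pi> b)) \<and>
     (\<forall>\<xi>. Vector_Spaces.linear scale scaleE (\<lambda>b. \<pi> b \<xi>)) \<and>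
     \<pi> one = id \<and> (\<forall>x y. \<pi> (mult x y) = \<pi> x \<circ> \<pi> y)"

definition group_representation ::
  "(complex \<Rightarrow> 'e::ab_group_add \<Rightarrow> 'e) \<Rightarrow> ('g::group_add \<Rightarrow> 'e \<Rightarrow> 'e) \<Rightarrow> bool" where
  "group_representation scaleE \<rho> \<longleftrightarrow>
     (\<forall>\<gamma>. Vector_Spaces.linear scaleE scaleE (\<rho> \<gamma>) \<and> bij (\<rho> \<gamma>)) \<and>
     (\<forall>\<gamma> \<mu>. \<rho> (\<gamma> + \<mu>) = \<rho> \<gamma> \<circ> \<rho> \<mu>)"

text \<open>
  In the next two definitions the left module structure on the space \<open>E\<close> is given by the
  representation \<open>\<pi>\<close>, that is, \<open>b \<xi> = \<pi> b \<xi>\<close>.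
\<close>

definition connection ::
  "(complex \<Rightarrow> 'e::ab_group_add \<Rightarrow> 'e) \<Rightarrow> ('b \<Rightarrow> 'e \<Rightarrow> 'e) \<Rightarrow> ('b \<Rightarrow> 'b) \<Rightarrow> ('e \<Rightarrow> 'e) \<Rightarrow> bool" where
  "connection scaleE \<pi> \<delta> D \<longleftrightarrow>
     Vector_Spaces.linear scaleE scaleE D \<and> (\<forall>b \<xi>. D (\<pi> b \<xi>) = \<pi> (\<delta> b) \<xi> + \<pi> b (D \<xi>))"

definition twisted_connection ::
  "(complex \<Rightarrow> 'e::ab_group_add \<Rightarrow> 'e) \<Rightarrow> ('b \<Rightarrow> 'e \<Rightarrow> 'e) \<Rightarrow> ('b \<Rightarrow> 'b) \<Rightarrow> ('b \<Rightarrow> 'b) \<Rightarrow>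
   ('e \<Rightarrow> 'e) \<Rightarrow> bool" where
  "twisted_connection scaleE \<pi> \<sigma> \<delta> D \<longleftrightarrow>
     Vector_Spaces.linear scaleE scaleE D \<and>
     (\<forall>b \<xi>. D (\<pi> b \<xi>) = \<pi> (\<delta> b) \<xi> + \<pi> (\<sigma> b) (D \<xi>))"


section \<open>Group actions and cocycles\<close>

locale algebra_action = complex_algebra scaleA "(*)" 1
  for scaleA :: "complex \<Rightarrow> 'a::{ring,monoid_mult} \<Rightarrow> 'a" +
  fixes act :: "'a \<Rightarrow> 'g::group_add \<Rightarrow> 'a"
  assumes act_zero: "act a 0 = a"
    and act_plus: "act a (\<gamma> + \<mu>) = act (act a \<gamma>) \<mu>"
    and act_automorphism: "algebra_automorphism scaleA (*) 1 (\<lambda>a. act a \<gamma>)"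

definition center :: "'a::semigroup_mult set" where
  "center = {z. \<forall>a. z * a = a * z}"

definition invertibles :: "'a::monoid_mult set" where
  "invertibles = {x. \<exists>y. x * y = 1 \<and> y * x = 1}"

definition unit_inv :: "'a::monoid_mult \<Rightarrow> 'a" where
  "unit_inv x = (THE y. x * y = 1 \<and> y * x = 1)"

definition cocycle :: "('a::monoid_mult \<Rightarrow> 'g::group_add \<Rightarrow> 'a) \<Rightarrow> ('g \<Rightarrow> 'a) \<Rightarrow> bool" where
  "cocycle act j \<longleftrightarrow>
     range j \<subseteq> center \<inter> invertibles \<and> (\<forall>\<gamma> \<mu>. j (\<gamma> + \<mu>) = act (j \<gamma>) \<mu> * j \<mu>)"


section \<open>The algebraic crossed product\<close>

text \<open>
  The vector space \<open>A \<otimes> \<complex>\<Gamma>\<close> is the direct sum of copies of \<open>A\<close> indexed by \<open>\<Gamma>\<close>, i.e. the type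
  \<^typ>\<open>'g \<Rightarrow>\<^sub>0 'a\<close>, in which \<open>a \<otimes> \<gamma>\<close> is \<^term>\<open>Poly_Mapping.single \<gamma> a\<close>. The instance of
  \<^class>\<open>times\<close> for that type is the untwisted convolution, hence not the product used here.
\<close>

abbreviation tensor :: "'a::zero \<Rightarrow> 'g \<Rightarrow> ('g \<Rightarrow>\<^sub>0 'a)" where
  "tensor a \<gamma> \<equiv> Poly_Mapping.single \<gamma> a"

text \<open>For \<open>F\<close> additive in its first argument, the additive map that sends \<open>a \<otimes> \<gamma>\<close> to \<open>F a \<gamma>\<close>.\<close>

definition tensor_extend ::
  "('a::zero \<Rightarrow> 'g \<Rightarrow> 'v::comm_monoid_add) \<Rightarrow> ('g \<Rightarrow>\<^sub>0 'a) \<Rightarrow> 'v" where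
  "tensor_extend F x = (\<Sum>\<gamma>\<in>Poly_Mapping.keys x. F (Poly_Mapping.lookup x \<gamma>) \<gamma>)"

definition crossed_scale ::
  "(complex \<Rightarrow> 'a::ab_group_add \<Rightarrow> 'a) \<Rightarrow> complex \<Rightarrow> ('g \<Rightarrow>\<^sub>0 'a) \<Rightarrow> ('g \<Rightarrow>\<^sub>0 'a)" where
  "crossed_scale scaleA c = tensor_extend (\<lambda>a \<gamma>. tensor (scaleA c a) \<gamma>)"

definition crossed_mult ::
  "('a::{ring,monoid_mult} \<Rightarrow> 'g::group_add \<Rightarrow> 'a) \<Rightarrow>
   ('g \<Rightarrow>\<^sub>0 'a) \<Rightarrow> ('g \<Rightarrow>\<^sub>0 'a) \<Rightarrow> ('g \<Rightarrow>\<^sub>0 'a)" where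
  "crossed_mult act x y =
     tensor_extend (\<lambda>a \<gamma>. tensor_extend (\<lambda>b \<mu>. tensor (act a \<mu> * b) (\<gamma> + \<mu>)) y) x"

definition crossed_one :: "'g::group_add \<Rightarrow>\<^sub>0 'a::{ring,monoid_mult}" where
  "crossed_one = tensor 1 0"

definition crossed_rep ::
  "('a::zero \<Rightarrow> 'e::comm_monoid_add \<Rightarrow> 'e) \<Rightarrow> ('g \<Rightarrow> 'e \<Rightarrow> 'e) \<Rightarrow> ('g \<Rightarrow>\<^sub>0 'a) \<Rightarrow> 'e \<Rightarrow> 'e" where
  "crossed_rep \<pi> \<rho> x \<xi> = tensor_extend (\<lambda>a \<gamma>. \<rho> \<gamma> (\<pi> a \<xi>)) x"

definition crossed_sigma ::
  "('a::{ring,monoid_mult} \<Rightarrow> 'g::group_add \<Rightarrow> 'a) \<Rightarrow> ('g \<Rightarrow> 'a) \<Rightarrow>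
   ('g \<Rightarrow>\<^sub>0 'a) \<Rightarrow> ('g \<Rightarrow>\<^sub>0 'a)" where
  "crossed_sigma act j = tensor_extend (\<lambda>a \<gamma>. tensor (act (j (- \<gamma>)) \<gamma> * a) \<gamma>)"

definition crossed_delta ::
  "('a::{ring,monoid_mult} \<Rightarrow> 'g::group_add \<Rightarrow> 'a) \<Rightarrow> ('g \<Rightarrow> 'a) \<Rightarrow> ('a \<Rightarrow> 'a) \<Rightarrow> nat \<Rightarrow>
   ('g \<Rightarrow>\<^sub>0 'a) \<Rightarrow> ('g \<Rightarrow>\<^sub>0 'a)" where
  "crossed_delta act j \<delta> s = tensor_extend (\<lambda>a \<gamma>.
     crossed_mult act
       (tensor (\<delta> (act a (- \<gamma>) * j (- \<gamma>) ^ s) * unit_inv (j (- \<gamma>)) ^ s) 0)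
       (tensor 1 \<gamma>))"

section \<open>Well-definedness\<close>

lemma tensor_extend_tensor:
  assumes "F 0 \<gamma> = 0"
  shows "tensor_extend F (tensor a \<gamma>) = F a \<gamma>"
  using assms by (cases "a = 0") (auto simp: tensor_extend_def)

lemma tensor_extend_add:
  fixes F :: "'a::ab_group_add \<Rightarrow> 'g \<Rightarrow> 'v::ab_group_add"
  assumes add: "\<And>\<gamma> a b. F (a + b) \<gamma> = F a \<gamma> + F b \<gamma>"
  shows "tensor_extend F (x + y) = tensor_extend F x + tensor_extend F y"
proof -
  have F0: "F 0 \<gamma> = 0" for \<gamma>
    using add[of 0 0 \<gamma>] by simp
  let ?K = "Poly_Mapping.keys x \<union> Poly_Mapping.keys y"
  have ext: "tensor_extend F z = (\<Sum>\<gamma>\<in>?K. F (Poly_Mapping.lookup z \<gamma>) \<gamma>)"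
    if "Poly_Mapping.keys z \<subseteq> ?K" for z
    unfolding tensor_extend_def
    by (rule sum.mono_neutral_left) (use that in \<open>auto simp: F0 in_keys_iff\<close>)
  show ?thesis
    by (subst (1 2 3) ext) (auto simp: Poly_Mapping.keys_add lookup_add add sum.distrib
        dest: subsetD[OF Poly_Mapping.keys_add])
qed

lemma additive_eqI:
  fixes f g :: "('g \<Rightarrow>\<^sub>0 'a::ab_group_add) \<Rightarrow> 'v::ab_group_add"
  assumes "\<And>x y. f (x + y) = f x + f y" "\<And>x y. g (x + y) = g x + g y"
    and "\<And>a \<gamma>. f (tensor a \<gamma>) = g (tensor a \<gamma>)"
  shows "f x = g x"
proof (induction x rule: update_induct)
  case const
  show ?case using assms(1,2)[of 0 0] by simp
next
  case (update x \<gamma> a)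
  have "Poly_Mapping.update \<gamma> a x = x + tensor a \<gamma>"
    using update(1)
    by (intro poly_mapping_eqI) (auto simp: lookup_update lookup_add lookup_single when_def in_keys_iff)
  then show ?case using update by (simp add: assms)
qed

context algebra_action
begin

lemma act_simps:
  "act (a + b) \<gamma> = act a \<gamma> + act b \<gamma>" "act 0 \<gamma> = 0" "act 1 \<gamma> = 1"
  "act (a * b) \<gamma> = act a \<gamma> * act b \<gamma>" "act (scaleA c a) \<gamma> = scaleA c (act a \<gamma>)"
proof -
  have *: "act (a + b) \<gamma> = act a \<gamma> + act b \<gamma>" for a b
    using act_automorphism[of \<gamma>] by (simp add: algebra_automorphism_def Vector_Spaces.linear_iff)
  show "act 0 \<gamma> = 0" using *[of 0 0] by simp
qed (use act_automorphism[of \<gamma>] in \<open>simp_all add: algebra_automorphism_def Vector_Spaces.linear_iff\<close>)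

lemma act_minus_cancel [simp]: "act (act a (- \<gamma>)) \<gamma> = a" "act (act a \<gamma>) (- \<gamma>) = a"
  by (simp_all flip: act_plus add: act_zero)

lemma act_power: "act (a ^ n) \<gamma> = act a \<gamma> ^ n"
  by (induction n) (simp_all add: act_simps)

lemma crossed_scale_tensor [simp]:
  "crossed_scale scaleA c (tensor a \<gamma>) = tensor (scaleA c a) \<gamma>"
  by (simp add: crossed_scale_def tensor_extend_tensor)

lemma crossed_scale_add:
  "crossed_scale scaleA c (x + y) = crossed_scale scaleA c x + crossed_scale scaleA c y"
  unfolding crossed_scale_def by (rule tensor_extend_add) (simp add: scale_right_distrib single_add)

lemma crossed_mult_add:
  "crossed_mult act (x + y) z = crossed_mult act x z + crossed_mult act y z"
  "crossed_mult act x (y + z) = crossed_mult act x y + crossed_mult act x z"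
proof -
  let ?G = "\<lambda>a \<gamma> y. tensor_extend (\<lambda>b \<mu>. tensor (act a \<mu> * b) (\<gamma> + \<mu>)) y"
  have G1: "?G (a + b) \<gamma> y = ?G a \<gamma> y + ?G b \<gamma> y" for a b \<gamma> y
    by (simp add: tensor_extend_def act_simps distrib_right single_add sum.distrib)
  have G2: "?G a \<gamma> (y + z) = ?G a \<gamma> y + ?G a \<gamma> z" for a \<gamma> y z
    by (rule tensor_extend_add) (simp add: distrib_left single_add)
  show "crossed_mult act (x + y) z = crossed_mult act x z + crossed_mult act y z"
    unfolding crossed_mult_def by (rule tensor_extend_add) (rule G1)
  show "crossed_mult act x (y + z) = crossed_mult act x y + crossed_mult act x z"
    unfolding crossed_mult_def G2 by (simp add: tensor_extend_def sum.distrib)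
qed

lemma crossed_mult_tensor [simp]:
  "crossed_mult act (tensor a \<gamma>) (tensor b \<mu>) = tensor (act a \<mu> * b) (\<gamma> + \<mu>)"
proof -
  have *: "tensor_extend (\<lambda>b \<mu>. tensor (act a \<mu> * b) (\<gamma> + \<mu>)) (tensor b \<mu>)
             = tensor (act a \<mu> * b) (\<gamma> + \<mu>)" for a \<gamma>
    by (rule tensor_extend_tensor) simp
  show ?thesis
    unfolding crossed_mult_def * by (rule tensor_extend_tensor) (simp add: act_simps)
qed

theorem crossed_product_algebra:
  "complex_algebra (crossed_scale scaleA) (crossed_mult act) crossed_one"
proof
  fix x y z :: "'g \<Rightarrow>\<^sub>0 'a" and c d :: complex
  show "crossed_scale scaleA c (x + y) = crossed_scale scaleA c x + crossed_scale scaleA c y"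
    by (rule crossed_scale_add)
  show "crossed_scale scaleA (c + d) x = crossed_scale scaleA c x + crossed_scale scaleA d x"
    by (rule additive_eqI) (simp_all add: crossed_scale_add scale_left_distrib single_add)
  show "crossed_scale scaleA c (crossed_scale scaleA d x) = crossed_scale scaleA (c * d) x"
    by (rule additive_eqI) (simp_all add: crossed_scale_add)
  show "crossed_scale scaleA 1 x = x"
    by (rule additive_eqI) (simp_all add: crossed_scale_add)
  show "crossed_mult act (x + y) z = crossed_mult act x z + crossed_mult act y z"
    "crossed_mult act x (y + z) = crossed_mult act x y + crossed_mult act x z"
    by (rule crossed_mult_add)+
  show "crossed_mult act crossed_one x = x" "crossed_mult act x crossed_one = x"
    by (rule additive_eqI, simp_all add: crossed_mult_add crossed_one_def act_simps act_zero)+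
  show "crossed_mult act (crossed_scale scaleA c x) y = crossed_scale scaleA c (crossed_mult act x y)"
  proof (rule additive_eqI[of "\<lambda>x. crossed_mult act (crossed_scale scaleA c x) y"
        "\<lambda>x. crossed_scale scaleA c (crossed_mult act x y)"]; (simp add: crossed_mult_add crossed_scale_add)?)
    fix a \<gamma>
    show "crossed_mult act (tensor (scaleA c a) \<gamma>) y = crossed_scale scaleA c (crossed_mult act (tensor a \<gamma>) y)"
      by (rule additive_eqI)
        (simp_all add: crossed_mult_add crossed_scale_add act_simps mult_scale_left)
  qed
  show "crossed_mult act x (crossed_scale scaleA c y) = crossed_scale scaleA c (crossed_mult act x y)"
  proof (rule additive_eqI[of "\<lambda>x. crossed_mult act x (crossed_scale scaleA c y)"
        "\<lambda>x. crossed_scale scaleA c (crossed_mult act x y)"]; (simp add: crossed_mult_add crossed_scale_add)?)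
    fix a \<gamma>
    show "crossed_mult act (tensor a \<gamma>) (crossed_scale scaleA c y) = crossed_scale scaleA c (crossed_mult act (tensor a \<gamma>) y)"
      by (rule additive_eqI)
        (simp_all add: crossed_mult_add crossed_scale_add act_simps mult_scale_right)
  qed
  show "crossed_mult act (crossed_mult act x y) z = crossed_mult act x (crossed_mult act y z)"
  proof (rule additive_eqI[of "\<lambda>x. crossed_mult act (crossed_mult act x y) z"
        "\<lambda>x. crossed_mult act x (crossed_mult act y z)"]; (simp add: crossed_mult_add)?)
    fix a \<gamma>
    show "crossed_mult act (crossed_mult act (tensor a \<gamma>) y) z = crossed_mult act (tensor a \<gamma>) (crossed_mult act y z)"
    proof (rule additive_eqI[of "\<lambda>y. crossed_mult act (crossed_mult act (tensor a \<gamma>) y) z"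
        "\<lambda>y. crossed_mult act (tensor a \<gamma>) (crossed_mult act y z)"]; (simp add: crossed_mult_add)?)
      fix b \<mu>
      show "crossed_mult act (tensor (act a \<mu> * b) (\<gamma> + \<mu>)) z =
            crossed_mult act (tensor a \<gamma>) (crossed_mult act (tensor b \<mu>) z)"
        by (rule additive_eqI)
          (simp_all add: crossed_mult_add act_simps act_plus mult.assoc add.assoc)
    qed
  qed
qed

lemma crossed_rep_add:
  assumes "algebra_representation scaleA (*) 1 scaleE \<pi>" "group_representation scaleE \<rho>"
  shows "crossed_rep \<pi> \<rho> (x + y) \<xi> = crossed_rep \<pi> \<rho> x \<xi> + crossed_rep \<pi> \<rho> y \<xi>"
  unfolding crossed_rep_def
  by (rule tensor_extend_add)
    (use assms in \<open>simp add: algebra_representation_def group_representation_def Vector_Spaces.linear_iff\<close>)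

lemma crossed_rep_tensor:
  assumes "algebra_representation scaleA (*) 1 scaleE \<pi>" "group_representation scaleE \<rho>"
  shows "crossed_rep \<pi> \<rho> (tensor a \<gamma>) \<xi> = \<rho> \<gamma> (\<pi> a \<xi>)"
proof -
  have "\<pi> (0 + 0) \<xi> = \<pi> 0 \<xi> + \<pi> 0 \<xi>" "\<rho> \<gamma> (0 + 0) = \<rho> \<gamma> 0 + \<rho> \<gamma> 0"
    using assms unfolding algebra_representation_def group_representation_def Vector_Spaces.linear_iff by blast+
  then have "\<pi> 0 \<xi> = 0" "\<rho> \<gamma> 0 = 0" by simp_all
  then show ?thesis by (simp add: crossed_rep_def tensor_extend_tensor)
qed

theorem crossed_rep_representation:
  assumes \<pi>: "algebra_representation scaleA (*) 1 scaleE \<pi>"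
    and \<rho>: "group_representation scaleE \<rho>"
    and cov: "\<And>a \<gamma>. \<pi> (act a \<gamma>) = \<rho> (- \<gamma>) \<circ> \<pi> a \<circ> \<rho> \<gamma>"
  shows "algebra_representation (crossed_scale scaleA) (crossed_mult act) crossed_one scaleE
           (crossed_rep \<pi> \<rho>)"
proof -
  interpret B: complex_algebra "crossed_scale scaleA" "crossed_mult act" crossed_one
    by (rule crossed_product_algebra)
  note add = crossed_rep_add[OF \<pi> \<rho>] and tens = crossed_rep_tensor[OF \<pi> \<rho>]
  have vs: "vector_space scaleE"
    using \<rho> by (simp add: group_representation_def Vector_Spaces.linear_iff)
  have \<pi>a: "\<pi> a (\<xi> + \<eta>) = \<pi> a \<xi> + \<pi> a \<eta>" "\<pi> a (scaleE c \<xi>) = scaleE c (\<pi> a \<xi>)"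
    "\<pi> (scaleA c a) \<xi> = scaleE c (\<pi> a \<xi>)" "\<pi> (a * b) \<xi> = \<pi> a (\<pi> b \<xi>)" "\<pi> 1 \<xi> = \<xi>" for a b c \<xi> \<eta>
    using \<pi> by (simp_all add: algebra_representation_def Vector_Spaces.linear_iff)
  have \<rho>a: "\<rho> \<gamma> (\<xi> + \<eta>) = \<rho> \<gamma> \<xi> + \<rho> \<gamma> \<eta>" "\<rho> \<gamma> (scaleE c \<xi>) = scaleE c (\<rho> \<gamma> \<xi>)"
    "\<rho> (\<gamma> + \<mu>) \<xi> = \<rho> \<gamma> (\<rho> \<mu> \<xi>)" "inj (\<rho> \<gamma>)" for \<gamma> \<mu> c \<xi> \<eta>
    using \<rho> by (simp_all add: group_representation_def Vector_Spaces.linear_iff bij_is_inj)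
  have \<rho>0: "\<rho> 0 \<xi> = \<xi>" for \<xi>
    using injD[OF \<rho>a(4)[of 0]] \<rho>a(3)[of 0 0 \<xi>] by simp
  have \<rho>inv: "\<rho> \<mu> (\<rho> (- \<mu>) \<xi>) = \<xi>" for \<mu> \<xi>
    using \<rho>a(3)[of \<mu> "- \<mu>" \<xi>] by (simp add: \<rho>0)
  have lin2: "crossed_rep \<pi> \<rho> (crossed_scale scaleA c x) \<xi> = scaleE c (crossed_rep \<pi> \<rho> x \<xi>)" for c x \<xi>
    by (rule additive_eqI)
      (simp_all add: add crossed_scale_add tens \<pi>a \<rho>a vector_space.vector_space_assms(1)[OF vs])
  have lin1: "crossed_rep \<pi> \<rho> x (\<xi> + \<eta>) = crossed_rep \<pi> \<rho> x \<xi> + crossed_rep \<pi> \<rho> x \<eta>" for x \<xi> \<eta>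
    by (rule additive_eqI) (simp_all add: add tens \<pi>a \<rho>a)
  have lin3: "crossed_rep \<pi> \<rho> x (scaleE c \<xi>) = scaleE c (crossed_rep \<pi> \<rho> x \<xi>)" for x c \<xi>
    by (rule additive_eqI) (simp_all add: add tens \<pi>a \<rho>a vector_space.vector_space_assms(1)[OF vs])
  have mult: "crossed_rep \<pi> \<rho> (crossed_mult act x y) \<xi> = crossed_rep \<pi> \<rho> x (crossed_rep \<pi> \<rho> y \<xi>)" for x y \<xi>
  proof (rule additive_eqI[of "\<lambda>x. crossed_rep \<pi> \<rho> (crossed_mult act x y) \<xi>"
        "\<lambda>x. crossed_rep \<pi> \<rho> x (crossed_rep \<pi> \<rho> y \<xi>)"]; (simp add: add crossed_mult_add)?)
    fix a \<gamma>
    show "crossed_rep \<pi> \<rho> (crossed_mult act (tensor a \<gamma>) y) \<xi> =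
          crossed_rep \<pi> \<rho> (tensor a \<gamma>) (crossed_rep \<pi> \<rho> y \<xi>)"
      by (rule additive_eqI)
        (simp_all add: add crossed_mult_add lin1 tens \<pi>a \<rho>a cov \<rho>inv)
  qed
  show ?thesis
    unfolding algebra_representation_def Vector_Spaces.linear_iff
    by (auto simp: lin1 lin2 lin3 add mult vs B.vector_space_axioms fun_eq_iff
        crossed_one_def tens \<pi>a \<rho>0)
qed

lemma center_commute: "z \<in> center \<Longrightarrow> z * a = a * z"
  by (simp add: center_def)

lemma unit_inv:
  assumes "x \<in> invertibles"
  shows "x * unit_inv x = 1" "unit_inv x * x = 1"
proof -
  obtain y where y: "x * y = 1" "y * x = 1" using assms by (auto simp: invertibles_def)
  have "x * unit_inv x = 1 \<and> unit_inv x * x = 1"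
    unfolding unit_inv_def
  proof (rule theI)
    show "x * y = 1 \<and> y * x = 1" using y by simp
    show "z = y" if "x * z = 1 \<and> z * x = 1" for z
      using that y by (metis mult.assoc mult_1_left mult_1_right)
  qed
  then show "x * unit_inv x = 1" "unit_inv x * x = 1" by simp_all
qed

end

locale crossed_cocycle = algebra_action scaleA act
  for scaleA :: "complex \<Rightarrow> 'a::{ring,monoid_mult} \<Rightarrow> 'a"
    and act :: "'a \<Rightarrow> 'g::group_add \<Rightarrow> 'a" +
  fixes j :: "'g \<Rightarrow> 'a"
  assumes cocycle: "cocycle act j"
begin

text \<open>The inverse of \<open>j \<gamma>\<close>, see \<open>u_j\<close> below.\<close>

definition u :: "'g \<Rightarrow> 'a" where "u \<gamma> = act (j (- \<gamma>)) \<gamma>"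

lemma j_comm: "j \<gamma> * a = a * j \<gamma>"
  using cocycle by (auto simp: cocycle_def intro: center_commute)

lemma j_inv: "j \<gamma> * unit_inv (j \<gamma>) = 1" "unit_inv (j \<gamma>) * j \<gamma> = 1"
  using cocycle by (auto simp: cocycle_def intro!: unit_inv)

lemma j_plus: "j (\<gamma> + \<mu>) = act (j \<gamma>) \<mu> * j \<mu>"
  using cocycle by (auto simp: cocycle_def)

lemma j_zero: "j 0 = 1"
proof -
  have "j 0 * j 0 = j 0" using j_plus[of 0 0] by (simp add: act_zero)
  then have "j 0 * (j 0 * unit_inv (j 0)) = j 0 * unit_inv (j 0)" by (simp flip: mult.assoc)
  then show ?thesis by (simp add: j_inv)
qed

lemma u_j: "u \<gamma> * j \<gamma> = 1" "j \<gamma> * u \<gamma> = 1"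
  using j_plus[of "- \<gamma>" \<gamma>] by (simp_all add: u_def j_zero j_comm)

lemma u_comm: "u \<gamma> * a = a * u \<gamma>"
proof -
  have "act (j (- \<gamma>) * act a (- \<gamma>)) \<gamma> = act (act a (- \<gamma>) * j (- \<gamma>)) \<gamma>"
    by (simp only: j_comm)
  then show ?thesis by (simp add: act_simps u_def)
qed

lemma u_plus: "u (\<gamma> + \<mu>) = act (u \<gamma>) \<mu> * u \<mu>"
proof -
  have "act (u \<gamma>) \<mu> * act (j \<gamma>) \<mu> = 1" by (metis act_simps(3,4) u_j(1))
  moreover have "(act (u \<gamma>) \<mu> * u \<mu>) * j (\<gamma> + \<mu>) = act (u \<gamma>) \<mu> * act (j \<gamma>) \<mu> * (u \<mu> * j \<mu>)"
    by (simp add: j_plus mult.assoc u_comm)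
  ultimately have "(act (u \<gamma>) \<mu> * u \<mu>) * j (\<gamma> + \<mu>) = 1"
    by (simp add: u_j)
  then show ?thesis by (metis mult.assoc mult_1_left mult_1_right u_j(2))
qed

lemma u_zero: "u 0 = 1"
  by (simp add: u_def j_zero act_zero)

lemma crossed_sigma_tensor [simp]: "crossed_sigma act j (tensor a \<gamma>) = tensor (u \<gamma> * a) \<gamma>"
  by (simp add: crossed_sigma_def tensor_extend_tensor u_def)

lemma crossed_sigma_add: "crossed_sigma act j (x + y) = crossed_sigma act j x + crossed_sigma act j y"
  unfolding crossed_sigma_def by (rule tensor_extend_add) (simp add: distrib_left single_add)

theorem crossed_sigma_automorphism:
  "algebra_automorphism (crossed_scale scaleA) (crossed_mult act) crossed_one (crossed_sigma act j)"
proof -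
  interpret B: complex_algebra "crossed_scale scaleA" "crossed_mult act" crossed_one
    by (rule crossed_product_algebra)
  let ?\<tau> = "tensor_extend (\<lambda>a \<gamma>. tensor (j \<gamma> * a) \<gamma>)"
  have \<tau>_add: "?\<tau> (x + y) = ?\<tau> x + ?\<tau> y" for x y
    by (rule tensor_extend_add) (simp add: distrib_left single_add)
  have \<tau>: "?\<tau> (tensor a \<gamma>) = tensor (j \<gamma> * a) \<gamma>" for a \<gamma>
    by (simp add: tensor_extend_tensor)
  have "?\<tau> (crossed_sigma act j x) = x" for x
    by (rule additive_eqI) (simp_all add: \<tau> \<tau>_add crossed_sigma_add u_j flip: mult.assoc)
  moreover have "crossed_sigma act j (?\<tau> x) = x" for x
    by (rule additive_eqI) (simp_all add: \<tau> \<tau>_add crossed_sigma_add u_j flip: mult.assoc)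
  ultimately have bij: "bij (crossed_sigma act j)"
    by (intro o_bij[of ?\<tau>]) (auto simp: fun_eq_iff)
  have lin: "crossed_sigma act j (crossed_scale scaleA c x) = crossed_scale scaleA c (crossed_sigma act j x)" for c x
    by (rule additive_eqI) (simp_all add: crossed_sigma_add crossed_scale_add mult_scale_right)
  have mult: "crossed_sigma act j (crossed_mult act x y) =
      crossed_mult act (crossed_sigma act j x) (crossed_sigma act j y)" for x y
  proof (rule additive_eqI[of "\<lambda>x. crossed_sigma act j (crossed_mult act x y)"
        "\<lambda>x. crossed_mult act (crossed_sigma act j x) (crossed_sigma act j y)"];
        (simp add: crossed_sigma_add crossed_mult_add)?)
    fix a \<gamma>
    have *: "act (u \<gamma>) \<mu> * (u \<mu> * (act a \<mu> * b)) = act (u \<gamma>) \<mu> * (act a \<mu> * (u \<mu> * b))" for b \<mu>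
      using u_comm[of \<mu> "act a \<mu>"] by (simp flip: mult.assoc)
    show "crossed_sigma act j (crossed_mult act (tensor a \<gamma>) y) =
          crossed_mult act (tensor (u \<gamma> * a) \<gamma>) (crossed_sigma act j y)"
      by (rule additive_eqI)
        (simp_all add: crossed_sigma_add crossed_mult_add u_plus act_simps mult.assoc *)
  qed
  show ?thesis
    unfolding algebra_automorphism_def Vector_Spaces.linear_iff
    by (auto simp: bij lin mult crossed_sigma_add B.vector_space_axioms crossed_one_def u_zero)
qed

text \<open>
  In closed form, \<open>\<delta>'\<^sub>s (a \<otimes> \<gamma>) = (u \<gamma> \<delta> a + s (\<delta> (u \<gamma>)) a) \<otimes> \<gamma>\<close>.
\<close>

theorem crossed_delta_twisted_derivation:
  assumes der: "derivation scaleA (*) \<delta>"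
    and \<delta>act: "\<And>a \<gamma>. \<delta> (act a \<gamma>) = act (\<delta> a) \<gamma> * j \<gamma>"
  shows "twisted_derivation (crossed_scale scaleA) (crossed_mult act) (crossed_sigma act j)
           (crossed_delta act j \<delta> s)"
proof -
  interpret B: complex_algebra "crossed_scale scaleA" "crossed_mult act" crossed_one
    by (rule crossed_product_algebra)
  have d: "\<delta> (a + b) = \<delta> a + \<delta> b" "\<delta> (scaleA c a) = scaleA c (\<delta> a)"
    "\<delta> (a * b) = \<delta> a * b + a * \<delta> b" for a b c
    using der by (simp_all add: derivation_def Vector_Spaces.linear_iff)
  have d1: "\<delta> 1 = 0" using d(3)[of 1 1] by simp
  have act\<delta>: "act (\<delta> a) \<gamma> = \<delta> (act a \<gamma>) * u \<gamma>" for a \<gamma>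
    by (simp add: \<delta>act mult.assoc u_j)
  have du_comm: "\<delta> (u \<gamma>) * a = a * \<delta> (u \<gamma>)" for a \<gamma>
  proof -
    have "\<delta> (u \<gamma> * a) = \<delta> (a * u \<gamma>)" by (simp only: u_comm)
    then show ?thesis using u_comm[of \<gamma> "\<delta> a"] by (simp add: d add.commute)
  qed
  define t where "t = scaleA (of_nat s)"
  have t: "t (a + b) = t a + t b" "a * t b = t (a * b)" "t a * b = t (a * b)"
    "t (scaleA c a) = scaleA c (t a)" "act (t a) \<gamma> = t (act a \<gamma>)" for a b c \<gamma>
    by (simp_all add: t_def scale_right_distrib mult_scale_left mult_scale_right act_simps mult.commute)
  let ?F = "\<lambda>a \<gamma>. u \<gamma> * \<delta> a + t (\<delta> (u \<gamma>) * a)"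
  have pow: "\<delta> (u \<gamma> ^ n) * u \<gamma> = scaleA (of_nat n) (\<delta> (u \<gamma>) * u \<gamma> ^ n)" for \<gamma> n
  proof (induction n)
    case (Suc n)
    have "\<delta> (u \<gamma> ^ Suc n) * u \<gamma> = \<delta> (u \<gamma>) * u \<gamma> ^ n * u \<gamma> + u \<gamma> * (\<delta> (u \<gamma> ^ n) * u \<gamma>)"
      by (simp add: d distrib_right mult.assoc)
    also have "\<dots> = \<delta> (u \<gamma>) * u \<gamma> ^ Suc n + scaleA (of_nat n) (\<delta> (u \<gamma>) * u \<gamma> ^ Suc n)"
      unfolding Suc
      by (simp add: mult_scale_right power_commutes mult.assoc flip: mult.assoc[of "u \<gamma>" "\<delta> _"] du_comm)
    finally show ?case by (simp add: scale_left_distrib)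
  qed (simp add: d1)
  have uinv: "act (unit_inv (j (- \<gamma>))) \<gamma> = j \<gamma>" for \<gamma>
  proof -
    have "u \<gamma> * act (unit_inv (j (- \<gamma>))) \<gamma> = 1"
      by (simp add: u_def j_inv act_simps flip: act_simps(4))
    then have "j \<gamma> * u \<gamma> * act (unit_inv (j (- \<gamma>))) \<gamma> = j \<gamma>" by (simp add: mult.assoc)
    then show ?thesis by (simp add: u_j)
  qed
  have uj_pow: "u \<gamma> ^ n * j \<gamma> ^ n = 1" for \<gamma> n
  proof (induction n)
    case (Suc n)
    have "u \<gamma> ^ Suc n * j \<gamma> ^ Suc n = u \<gamma> * (u \<gamma> ^ n * j \<gamma> ^ n) * j \<gamma>"
      by (simp add: mult.assoc power_commutes)
    then show ?case by (simp only: Suc mult_1_right u_j)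
  qed simp
  have formula: "act (\<delta> (act a (- \<gamma>) * j (- \<gamma>) ^ s) * unit_inv (j (- \<gamma>)) ^ s) \<gamma> = ?F a \<gamma>" for a \<gamma>
  proof -
    have "act (\<delta> (act a (- \<gamma>) * j (- \<gamma>) ^ s) * unit_inv (j (- \<gamma>)) ^ s) \<gamma>
        = \<delta> (a * u \<gamma> ^ s) * u \<gamma> * j \<gamma> ^ s"
      by (simp add: act_simps act_power uinv act\<delta>) (simp add: u_def)
    also have "\<dots> = \<delta> a * (u \<gamma> ^ s * u \<gamma>) * j \<gamma> ^ s + a * (\<delta> (u \<gamma> ^ s) * u \<gamma>) * j \<gamma> ^ s"
      by (simp add: d distrib_right mult.assoc)
    also have "\<dots> = \<delta> a * u \<gamma> * (u \<gamma> ^ s * j \<gamma> ^ s) + t (a * \<delta> (u \<gamma>) * (u \<gamma> ^ s * j \<gamma> ^ s))"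
      by (simp add: pow flip: t_def) (simp add: t mult.assoc power_commutes)
    finally show ?thesis by (simp add: uj_pow u_comm du_comm)
  qed
  have eq: "crossed_delta act j \<delta> s = tensor_extend (\<lambda>a \<gamma>. tensor (?F a \<gamma>) \<gamma>)"
    by (simp add: crossed_delta_def formula)
  have F_add: "?F (a + b) \<gamma> = ?F a \<gamma> + ?F b \<gamma>" for a b \<gamma>
    by (simp add: d distrib_left t)
  have add: "crossed_delta act j \<delta> s (x + y) = crossed_delta act j \<delta> s x + crossed_delta act j \<delta> s y" for x y
    unfolding eq by (rule tensor_extend_add) (simp only: F_add single_add)
  have tens: "crossed_delta act j \<delta> s (tensor a \<gamma>) = tensor (?F a \<gamma>) \<gamma>" for a \<gamma>
    unfolding eq by (rule tensor_extend_tensor) (use F_add[of \<gamma> 0 0] in simp)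
  have lin: "crossed_delta act j \<delta> s (crossed_scale scaleA c x) = crossed_scale scaleA c (crossed_delta act j \<delta> s x)" for c x
    by (rule additive_eqI)
      (simp_all add: add crossed_scale_add tens d t mult_scale_right scale_right_distrib)
  have key: "?F (act a \<mu> * b) (\<gamma> + \<mu>) = act (?F a \<gamma>) \<mu> * b + act (u \<gamma> * a) \<mu> * ?F b \<mu>" for a b \<gamma> \<mu>
  proof -
    have 1: "u (\<gamma> + \<mu>) * \<delta> (act a \<mu> * b) =
        act (u \<gamma>) \<mu> * (u \<mu> * \<delta> (act a \<mu>)) * b + act (u \<gamma>) \<mu> * (u \<mu> * act a \<mu>) * \<delta> b"
      by (simp add: u_plus d distrib_left mult.assoc)
    have "\<delta> (u (\<gamma> + \<mu>)) = \<delta> (act (u \<gamma>) \<mu>) * u \<mu> + act (u \<gamma>) \<mu> * \<delta> (u \<mu>)"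
      by (simp add: u_plus d)
    then have 2: "\<delta> (u (\<gamma> + \<mu>)) * (act a \<mu> * b) =
        act (\<delta> (u \<gamma>)) \<mu> * act a \<mu> * b + act (u \<gamma>) \<mu> * (\<delta> (u \<mu>) * act a \<mu>) * b"
      by (simp add: act\<delta> distrib_right mult.assoc)
    have 3: "act (?F a \<gamma>) \<mu> * b = act (u \<gamma>) \<mu> * \<delta> (act a \<mu>) * u \<mu> * b +
        t (act (\<delta> (u \<gamma>)) \<mu> * act a \<mu> * b)"
      by (simp add: act_simps act\<delta>[of a] t distrib_right mult.assoc)
    have 4: "act (u \<gamma> * a) \<mu> * ?F b \<mu> = act (u \<gamma>) \<mu> * act a \<mu> * u \<mu> * \<delta> b +
        t (act (u \<gamma>) \<mu> * act a \<mu> * \<delta> (u \<mu>) * b)"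
      by (simp add: act_simps t distrib_left mult.assoc)
    show ?thesis
      unfolding 1 2 3 4 u_comm[of \<mu> "act a \<mu>"] du_comm[of \<mu> "act a \<mu>"] u_comm[of \<mu> "\<delta> (act a \<mu>)"]
      by (simp add: t mult.assoc)
  qed
  have leibniz: "crossed_delta act j \<delta> s (crossed_mult act x y) =
      crossed_mult act (crossed_delta act j \<delta> s x) y +
      crossed_mult act (crossed_sigma act j x) (crossed_delta act j \<delta> s y)" for x y
  proof (rule additive_eqI[of "\<lambda>x. crossed_delta act j \<delta> s (crossed_mult act x y)"
        "\<lambda>x. crossed_mult act (crossed_delta act j \<delta> s x) y +
             crossed_mult act (crossed_sigma act j x) (crossed_delta act j \<delta> s y)"];
        (simp add: add crossed_sigma_add crossed_mult_add)?)
    fix a \<gamma>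
    show "crossed_delta act j \<delta> s (crossed_mult act (tensor a \<gamma>) y) =
      crossed_mult act (crossed_delta act j \<delta> s (tensor a \<gamma>)) y +
      crossed_mult act (tensor (u \<gamma> * a) \<gamma>) (crossed_delta act j \<delta> s y)"
    proof (rule additive_eqI[of "\<lambda>y. crossed_delta act j \<delta> s (crossed_mult act (tensor a \<gamma>) y)"
        "\<lambda>y. crossed_mult act (crossed_delta act j \<delta> s (tensor a \<gamma>)) y +
             crossed_mult act (tensor (u \<gamma> * a) \<gamma>) (crossed_delta act j \<delta> s y)"];
        (simp add: add crossed_mult_add)?)
      fix b \<mu>
      show "crossed_delta act j \<delta> s (tensor (act a \<mu> * b) (\<gamma> + \<mu>)) =
        crossed_mult act (crossed_delta act j \<delta> s (tensor a \<gamma>)) (tensor b \<mu>) +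
        crossed_mult act (tensor (u \<gamma> * a) \<gamma>) (crossed_delta act j \<delta> s (tensor b \<mu>))"
        by (simp only: tens key crossed_mult_tensor) (rule single_add)
    qed
  qed
  show ?thesis
    unfolding twisted_derivation_def Vector_Spaces.linear_iff
    by (simp add: add lin leibniz B.vector_space_axioms)
qed

end

end

theory Submission
  imports Defs
begin

text \<open>
  Write \<open>u \<gamma> = j(\<gamma>\<inverse>) \<cdot> \<gamma> = (j \<gamma>)\<inverse>\<close>. As \<open>a \<otimes> \<gamma> = (1 \<otimes> \<gamma>)(a \<otimes> 1)\<close>, the twisted Leibniz rule
  only has to be tested on the generators \<open>a \<otimes> 1\<close>, where it is the rule for \<open>A\<close>, and \<open>1 \<otimes> \<gamma>\<close>. Since
  \<open>\<delta>'\<^sub>s (1 \<otimes> \<gamma>) = s \<delta>(u \<gamma>) \<otimes> \<gamma>\<close>, the latter reads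
  \<open>\<nabla> \<rho>(\<gamma>) = \<rho>(\<gamma>) (s \<pi>(\<delta>(u \<gamma>)) + \<pi>(u \<gamma>) \<nabla>)\<close>, and moving \<open>\<nabla>\<close> to the left of \<open>\<pi>(u \<gamma>)\<close> absorbs one
  of the \<open>s\<close> copies of \<open>\<pi>(\<delta>(u \<gamma>))\<close>.
\<close>

lemma unit_inv_one: "unit_inv 1 = (1::'a::monoid_mult)"
  unfolding unit_inv_def by (rule the_equality) auto

context complex_algebra
begin

lemma derivation_one:
  assumes "derivation scale mult d"
  shows "d one = 0"
proof -
  have "d (mult one one) = mult (d one) one + mult one (d one)"
    using assms by (simp add: derivation_def)
  then show ?thesis by (simp add: mult_one_left mult_one_right)
qed

end

context algebra_action
begin

text \<open>On central units the logarithmic derivative \<open>\<delta> x * y\<close> turns products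
  into sums, so each factor of the power contributes one copy.\<close>

lemma derivation_power_times_inverse_power:
  assumes der: "derivation scaleA (*) \<delta>"
    and comm: "\<And>a. x * a = a * x" and inv: "x * y = 1"
  shows "\<delta> (x ^ n) * y ^ n = scaleA (of_nat n) (\<delta> x * y)"
proof (induction n)
  case 0
  show ?case by (simp add: derivation_one[OF der])
next
  case (Suc n)
  have xy_pow: "x ^ k * y ^ k = 1" for k
  proof (induction k)
    case (Suc k)
    have "x ^ Suc k * y ^ Suc k = x * (x ^ k * y ^ k) * y"
      by (simp add: mult.assoc power_commutes)
    then show ?case by (simp only: Suc mult_1_right inv)
  qed simp
  have "\<delta> (x ^ Suc n) * y ^ Suc n = (\<delta> x * x ^ n + x * \<delta> (x ^ n)) * (y ^ n * y)"
    using der by (simp add: derivation_def power_commutes)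
  \<comment> \<open>Centrality carries the leading \<open>x\<close> of the second summand to the
    right, where it meets the last \<open>y\<close>.\<close>
  also have "\<dots> = \<delta> x * (x ^ n * y ^ n) * y + (\<delta> (x ^ n) * y ^ n) * (x * y)"
    unfolding distrib_right by (simp add: mult.assoc comm flip: comm[of "y ^ n * y"])
  also have "\<dots> = \<delta> x * y + scaleA (of_nat n) (\<delta> x * y)"
    by (simp only: xy_pow inv Suc mult_1_right)
  finally show ?case by (simp add: scale_left_distrib)
qed

end

context crossed_cocycle
begin

text \<open>Acting by \<open>\<gamma>\<close> preserves products, so the left side is inverse to
  \<open>u \<gamma>\<close>, and so is \<open>j \<gamma>\<close> by \<open>u_j\<close>.\<close>

lemma act_unit_inv_j: "act (unit_inv (j (- \<gamma>))) \<gamma> = j \<gamma>"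
proof -
  have "u \<gamma> * act (unit_inv (j (- \<gamma>))) \<gamma> = 1"
    by (simp add: u_def j_inv act_simps flip: act_simps(4))
  then have "j \<gamma> * u \<gamma> * act (unit_inv (j (- \<gamma>))) \<gamma> = j \<gamma>" by (simp add: mult.assoc)
  then show ?thesis by (simp add: u_j)
qed

text \<open>The twisted Leibniz rule for \<open>tensor 1 \<gamma>\<close> times
  \<open>tensor a 0\<close> reduces the defining formula to the two cases
  \<open>\<gamma> = 0\<close> and \<open>a = 1\<close>.\<close>

lemma crossed_delta_tensor:
  assumes der: "derivation scaleA (*) \<delta>"
    and \<delta>act: "\<And>a \<gamma>. \<delta> (act a \<gamma>) = act (\<delta> a) \<gamma> * j \<gamma>"
  shows "crossed_delta act j \<delta> s (tensor a \<gamma>) =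
    tensor (scaleA (of_nat s) (\<delta> (u \<gamma>) * a) + u \<gamma> * \<delta> a) \<gamma>"
proof -
  have \<delta>0: "\<delta> 0 = 0"
    using der by (metis derivation_def mult_zero_left mult_zero_right add_0)
  have eval: "crossed_delta act j \<delta> s (tensor a \<gamma>) =
      tensor (act (\<delta> (act a (- \<gamma>) * j (- \<gamma>) ^ s) * unit_inv (j (- \<gamma>)) ^ s) \<gamma>) \<gamma>" for a \<gamma>
    \<comment> \<open>\<open>tensor_extend_tensor\<close> requires the summand to vanish at
      \<open>a = 0\<close>; this comes from \<open>\<delta>0\<close> and the instance at zero, which
      says that zero times a tensor is zero.\<close>
    unfolding crossed_delta_def using crossed_mult_tensor[of 0 0]
    by (subst tensor_extend_tensor) (simp_all add: act_simps \<delta>0)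
  have zero: "crossed_delta act j \<delta> s (tensor a 0) = tensor (\<delta> a) 0"
    unfolding eval by (simp add: j_zero unit_inv_one act_zero)
  have "act (\<delta> (j (- \<gamma>))) \<gamma> * j \<gamma> = \<delta> (u \<gamma>)"
    by (simp add: u_def \<delta>act)
  \<comment> \<open>For \<open>a = 1\<close> the coefficient is the logarithmic derivative of
    \<open>j (- \<gamma>) ^ s\<close>, that is, \<open>s\<close> times that of
    \<open>j (- \<gamma>)\<close>, which the action of \<open>\<gamma>\<close> carries to
    \<open>\<delta> (u \<gamma>)\<close>.\<close>
  then have one: "crossed_delta act j \<delta> s (tensor 1 \<gamma>) = tensor (scaleA (of_nat s) (\<delta> (u \<gamma>))) \<gamma>"
    unfolding eval
    by (simp add: act_simps act_unit_inv_j derivation_power_times_inverse_power[OF der j_comm j_inv(1)])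
  have "crossed_delta act j \<delta> s (crossed_mult act (tensor 1 \<gamma>) (tensor a 0)) =
      crossed_mult act (crossed_delta act j \<delta> s (tensor 1 \<gamma>)) (tensor a 0) +
      crossed_mult act (crossed_sigma act j (tensor 1 \<gamma>)) (crossed_delta act j \<delta> s (tensor a 0))"
    using crossed_delta_twisted_derivation[OF der \<delta>act, of s]
    unfolding twisted_derivation_def by blast
  then show ?thesis
    by (simp add: zero one act_zero act_simps mult_scale_left single_add)
qed

theorem twisted_connection_crossed_iff:
  assumes \<pi>: "algebra_representation scaleA (*) 1 scaleE \<pi>"
    and \<rho>: "group_representation scaleE \<rho>"
    and der: "derivation scaleA (*) \<delta>"
    and \<delta>act: "\<And>a \<gamma>. \<delta> (act a \<gamma>) = act (\<delta> a) \<gamma> * j \<gamma>"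
    and conn: "connection scaleE \<pi> \<delta> D"
  shows "twisted_connection scaleE (crossed_rep \<pi> \<rho>) (crossed_sigma act j)
           (crossed_delta act j \<delta> s) D \<longleftrightarrow>
         (\<forall>\<gamma> \<xi>. D (\<rho> \<gamma> \<xi>) = \<rho> \<gamma> (scaleE (of_nat s) (\<pi> (\<delta> (u \<gamma>)) \<xi>) + \<pi> (u \<gamma>) (D \<xi>)))"
    (is "?twisted \<longleftrightarrow> ?gen")
proof -
  note rep_add = crossed_rep_add[OF \<pi> \<rho>] and rep_tensor = crossed_rep_tensor[OF \<pi> \<rho>]
  have \<pi>_simps: "\<pi> a (\<xi> + \<eta>) = \<pi> a \<xi> + \<pi> a \<eta>" "\<pi> (a + b) \<xi> = \<pi> a \<xi> + \<pi> b \<xi>"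
    "\<pi> (scaleA c a) \<xi> = scaleE c (\<pi> a \<xi>)" "\<pi> (a * b) \<xi> = \<pi> a (\<pi> b \<xi>)" "\<pi> 1 \<xi> = \<xi>" for a b c \<xi> \<eta>
    using \<pi> by (simp_all add: algebra_representation_def Vector_Spaces.linear_iff)
  have \<rho>_add: "\<rho> \<gamma> (\<xi> + \<eta>) = \<rho> \<gamma> \<xi> + \<rho> \<gamma> \<eta>" for \<gamma> \<xi> \<eta>
    using \<rho> by (simp add: group_representation_def Vector_Spaces.linear_iff)
  have lin: "Vector_Spaces.linear scaleE scaleE D" and D_\<pi>: "D (\<pi> a \<xi>) = \<pi> (\<delta> a) \<xi> + \<pi> a (D \<xi>)" for a \<xi>
    using conn by (simp_all add: connection_def)
  have D_add: "D (\<xi> + \<eta>) = D \<xi> + D \<eta>" for \<xi> \<eta>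
    using lin by (simp add: Vector_Spaces.linear_iff)
  have \<delta>'_add: "crossed_delta act j \<delta> s (x + y) = crossed_delta act j \<delta> s x + crossed_delta act j \<delta> s y" for x y
    using crossed_delta_twisted_derivation[OF der \<delta>act, of s]
    by (simp add: twisted_derivation_def Vector_Spaces.linear_iff)
  note \<delta>'_tensor = crossed_delta_tensor[OF der \<delta>act]
  show ?thesis
  proof
    assume ?twisted
    then have "D (crossed_rep \<pi> \<rho> (tensor 1 \<gamma>) \<xi>) =
        crossed_rep \<pi> \<rho> (crossed_delta act j \<delta> s (tensor 1 \<gamma>)) \<xi> +
        crossed_rep \<pi> \<rho> (crossed_sigma act j (tensor 1 \<gamma>)) (D \<xi>)" for \<gamma> \<xi>
      by (simp only: twisted_connection_def)
    then show ?gen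
      \<comment> \<open>The summand \<open>u \<gamma> * \<delta> 1\<close> drops out because
        \<open>\<delta> 1 = 0\<close>.\<close>
      by (simp add: rep_tensor \<delta>'_tensor \<pi>_simps \<rho>_add derivation_one[OF der])
  next
    assume gen: ?gen
    \<comment> \<open>Both sides are additive in \<open>x\<close>. On
      \<open>tensor a \<gamma>\<close>, \<open>gen\<close> is applied to the vector
      \<open>\<pi> a \<xi>\<close>, and then the connection rule moves \<open>D\<close> past
      \<open>\<pi> a\<close>.\<close>
    have "D (crossed_rep \<pi> \<rho> x \<xi>) = crossed_rep \<pi> \<rho> (crossed_delta act j \<delta> s x) \<xi> +
        crossed_rep \<pi> \<rho> (crossed_sigma act j x) (D \<xi>)" for x \<xi>
      by (rule additive_eqI)
        (simp_all add: rep_add D_add \<delta>'_add crossed_sigma_add rep_tensor \<delta>'_tensor gen D_\<pi>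
          \<pi>_simps \<rho>_add add.assoc)
    then show ?twisted by (simp add: twisted_connection_def lin)
  qed
qed

end

theorem proposition6p4:
  fixes scaleA :: "complex \<Rightarrow> 'a::{ring,monoid_mult} \<Rightarrow> 'a"
    and act :: "'a \<Rightarrow> 'g::group_add \<Rightarrow> 'a"
    and scaleE :: "complex \<Rightarrow> 'e::ab_group_add \<Rightarrow> 'e"
    and \<pi> :: "'a \<Rightarrow> 'e \<Rightarrow> 'e"
    and \<rho> :: "'g \<Rightarrow> 'e \<Rightarrow> 'e"
    and j :: "'g \<Rightarrow> 'a"
    and \<delta> :: "'a \<Rightarrow> 'a"
    and s :: nat
    and D :: "'e \<Rightarrow> 'e"
  assumes "algebra_action scaleA act"
    and "vector_space scaleE"
    and "algebra_representation scaleA (*) 1 scaleE \<pi>"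
    and "group_representation scaleE \<rho>"
    and "\<And>a \<gamma>. \<pi> (act a \<gamma>) = \<rho> (- \<gamma>) \<circ> \<pi> a \<circ> \<rho> \<gamma>"
    and "cocycle act j"
    and "derivation scaleA (*) \<delta>"
    and "\<And>a \<gamma>. \<delta> (act a \<gamma>) = act (\<delta> a) \<gamma> * j \<gamma>"
    and "s \<ge> 1"
    and "connection scaleE \<pi> \<delta> D"
  shows "twisted_connection scaleE (crossed_rep \<pi> \<rho>) (crossed_sigma act j)
           (crossed_delta act j \<delta> s) D \<longleftrightarrow>
         (\<forall>\<gamma>. D \<circ> \<rho> \<gamma> = \<rho> \<gamma> \<circ>
           (\<lambda>\<xi>. scaleE (of_nat s - 1) (\<pi> (\<delta> (act (j (- \<gamma>)) \<gamma>)) \<xi>) + D (\<pi> (act (j (- \<gamma>)) \<gamma>) \<xi>)))"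
proof -
  interpret crossed_cocycle scaleA act j
    using assms(1,6) by (simp add: crossed_cocycle_def crossed_cocycle_axioms_def)
  interpret E: vector_space scaleE by (rule assms(2))
  \<comment> \<open>The difference \<open>of_nat s - 1\<close> is a complex number, so nothing is
    truncated; the missing copy is the derivative term of
    \<open>D (\<pi> (u \<gamma>) \<xi>)\<close>.\<close>
  have "scaleE (of_nat s - 1) (\<pi> (\<delta> (u \<gamma>)) \<xi>) + D (\<pi> (u \<gamma>) \<xi>) =
      scaleE (of_nat s) (\<pi> (\<delta> (u \<gamma>)) \<xi>) + \<pi> (u \<gamma>) (D \<xi>)" for \<gamma> \<xi>
    using assms(10) by (simp add: connection_def E.scale_left_diff_distrib)
  then show ?thesis
    using twisted_connection_crossed_iff[OF assms(3,4,7,8,10), of s]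
    by (simp add: fun_eq_iff flip: u_def)
qed

end
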